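(* Let $K$ be a compact space, let $p$ be a $P$-point of $K$, let $\kappa=\pi\chi(p,K)$, and suppose that $K$ has cellularity $\mathfrak c<\kappa$. Let $X=K\setminus\{p\}$. Topologize the set $\kappa+1$ so that it is the one-point compactification of the discrete space $\kappa$ (with $\kappa$ as the point at infinity). Then the space $X$ is cellular-compact, but the product space $X\times(\kappa+1)$ is not cellular-Lindelöf.
   Context: All spaces are Hausdorff. $\mathfrak c=2^{\aleph_0}$. A point $p$ of a space $K$ is a $P$-point if every countable intersection of neighborhoods of $p$ is a neighborhood of $p$. The cellularity of $K$ is the supremum of the cardinalities of families of pairwise disjoint nonempty open subsets of $K$. A local $\pi$-base for $p$ in $K$ is a family $\mathcal V$ of nonempty open subsets of $K$ such that every open set containing $p$ contains some member of $\mathcal V$; $\pi\chi(p,K)$ is the minimal cardinality of a local $\pi$-base for $p$ in $K$. A space $X$ is cellular-Lindelöf (respectively, cellular-compact) if for every family $\mathcal U$ of pairwise disjoint nonempty open subsets of $X$ there is a Lindelöf (respectively, compact) subspace $L\subset X$ such that $L\cap U\neq\emptyset$ for every $U\in\mathcal U$. *)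

theory Defs
  imports "HOL-Analysis.Analysis"
begin

unbundle cardinal_syntax
no_notation elt_set_eq (infix \<open>=o\<close> 50)

definition neighborhood_in :: "'a topology \<Rightarrow> 'a \<Rightarrow> 'a set \<Rightarrow> bool" where
  "neighborhood_in K p N \<longleftrightarrow>
     N \<subseteq> topspace K \<and> (\<exists>U. openin K U \<and> p \<in> U \<and> U \<subseteq> N)"

(* The empty family is excluded because its intersection is UNIV rather than topspace K. *)
definition P_point :: "'a topology \<Rightarrow> 'a \<Rightarrow> bool" where
  "P_point K p \<longleftrightarrow>
     p \<in> topspace K \<and>
     (\<forall>\<N>. countable \<N> \<and> \<N> \<noteq> {} \<and> (\<forall>N\<in>\<N>. neighborhood_in K p N)
          \<longrightarrow> neighborhood_in K p (\<Inter>\<N>))"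

definition cellular_family :: "'a topology \<Rightarrow> 'a set set \<Rightarrow> bool" where
  "cellular_family K \<U> \<longleftrightarrow>
     (\<forall>U\<in>\<U>. openin K U \<and> U \<noteq> {}) \<and> pairwise disjnt \<U>"

(* Cardinals are determined up to =o.  The supremum of the cardinalities of the cellular
   families is at most the cardinality of the type 'a set, so that it suffices to compare
   with upper bounds \<nu> on that type (see has_cellularity_exists, has_cellularity_unique). *)
definition has_cellularity :: "'a topology \<Rightarrow> 'b rel \<Rightarrow> bool" where
  "has_cellularity K \<mu> \<longleftrightarrow>
     Card_order \<mu> \<and>
     (\<forall>\<U>. cellular_family K \<U> \<longrightarrow> |\<U>| \<le>o \<mu>) \<and>
     (\<forall>\<nu> :: 'a set rel.
        Card_order \<nu> \<and> (\<forall>\<U>. cellular_family K \<U> \<longrightarrow> |\<U>| \<le>o \<nu>) \<longrightarrow> \<mu> \<le>o \<nu>)"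

definition local_pi_base :: "'a topology \<Rightarrow> 'a \<Rightarrow> 'a set set \<Rightarrow> bool" where
  "local_pi_base K p \<V> \<longleftrightarrow>
     (\<forall>V\<in>\<V>. openin K V \<and> V \<noteq> {}) \<and>
     (\<forall>U. openin K U \<and> p \<in> U \<longrightarrow> (\<exists>V\<in>\<V>. V \<subseteq> U))"

definition has_pi_character :: "'a topology \<Rightarrow> 'a \<Rightarrow> 'b rel \<Rightarrow> bool" where
  "has_pi_character K p \<kappa> \<longleftrightarrow>
     Card_order \<kappa> \<and>
     (\<exists>\<V>. local_pi_base K p \<V> \<and> |\<V>| =o \<kappa>) \<and>
     (\<forall>\<V>. local_pi_base K p \<V> \<longrightarrow> \<kappa> \<le>o |\<V>| )"

definition cellular_Lindelof :: "'a topology \<Rightarrow> bool" where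
  "cellular_Lindelof X \<longleftrightarrow>
     (\<forall>\<U>. cellular_family X \<U> \<longrightarrow>
        (\<exists>L. L \<subseteq> topspace X \<and> Lindelof_space (subtopology X L) \<and> (\<forall>U\<in>\<U>. L \<inter> U \<noteq> {})))"

definition cellular_compact :: "'a topology \<Rightarrow> bool" where
  "cellular_compact X \<longleftrightarrow>
     (\<forall>\<U>. cellular_family X \<U> \<longrightarrow>
        (\<exists>L. compactin X L \<and> (\<forall>U\<in>\<U>. L \<inter> U \<noteq> {})))"

lemma has_cellularity_exists: "\<exists>\<mu> :: 'a set rel. has_cellularity (K :: 'a topology) \<mu>"
proof -
  define R where "R = {\<nu> :: 'a set rel. Card_order \<nu> \<and> (\<forall>\<U>. cellular_family K \<U> \<longrightarrow> |\<U>| \<le>o \<nu>)}"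
  have "|UNIV :: 'a set set| \<in> R"
    unfolding R_def by (auto intro!: card_of_Card_order card_of_mono1)
  then obtain \<mu> where "\<mu> \<in> R" "\<forall>\<nu>\<in>R. \<mu> \<le>o \<nu>"
    using exists_minim_Card_order[of R] unfolding R_def by blast
  then have "has_cellularity K \<mu>"
    unfolding has_cellularity_def R_def by simp
  then show ?thesis
    by blast
qed

lemma has_cellularity_le:
  fixes K :: "'a topology" and \<mu> :: "'b rel" and \<mu>' :: "'c rel"
  assumes "has_cellularity K \<mu>" and "has_cellularity K \<mu>'"
  shows "\<mu> \<le>o \<mu>'"
proof -
  obtain \<nu> :: "'a set rel" where \<nu>: "has_cellularity K \<nu>"
    using has_cellularity_exists by blast
  have le: "\<mu>' \<le>o \<nu>"
    using \<nu> assms(2) unfolding has_cellularity_def by simp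
  have c: "Card_order \<mu>'" and ub: "\<And>\<U>. cellular_family K \<U> \<Longrightarrow> |\<U>| \<le>o \<mu>'"
    using assms(2) unfolding has_cellularity_def by auto
  obtain f where f: "inj_on f (Field \<mu>')" "f ` Field \<mu>' \<subseteq> Field \<nu>"
    using iffD2[OF card_of_ordLeq card_of_mono2[OF le]] by (elim exE conjE)
  have "|Field \<mu>'| =o |f ` Field \<mu>'|"
    by (rule card_of_ordIsoI[OF inj_on_imp_bij_betw[OF f(1)]])
  then have iso: "\<mu>' =o |f ` Field \<mu>'|"
    by (rule ordIso_transitive[OF ordIso_symmetric[OF card_of_Field_ordIso[OF c]]])
  have "\<mu> \<le>o |f ` Field \<mu>'|"
    using assms(1)[unfolded has_cellularity_def, THEN conjunct2, THEN conjunct2, rule_format,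
        OF conjI[OF card_of_Card_order allI[OF impI]]] ordLeq_ordIso_trans[OF ub iso]
    by simp
  then show ?thesis
    by (rule ordLeq_ordIso_trans[OF _ ordIso_symmetric[OF iso]])
qed

lemma has_cellularity_unique:
  assumes "has_cellularity K \<mu>" and "has_cellularity K \<mu>'"
  shows "\<mu> =o \<mu>'"
  using has_cellularity_le[OF assms] has_cellularity_le[OF assms(2,1)]
  by (simp add: ordIso_iff_ordLeq)

lemma has_pi_character_exists:
  assumes "p \<in> topspace K"
  shows "\<exists>\<kappa> :: 'a set rel. has_pi_character (K :: 'a topology) p \<kappa>"
proof -
  define R where "R = card_of ` {\<V>. local_pi_base K p \<V>}"
  have "local_pi_base K p {V. openin K V \<and> V \<noteq> {}}"
    unfolding local_pi_base_def by blast
  then have "R \<noteq> {}"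
    unfolding R_def by blast
  moreover have "\<forall>r\<in>R. Card_order r"
    unfolding R_def using card_of_Card_order by blast
  ultimately obtain \<kappa> where "\<kappa> \<in> R" "\<forall>r\<in>R. \<kappa> \<le>o r"
    using exists_minim_Card_order[of R] by blast
  then obtain \<V> where \<V>: "\<kappa> = |\<V>|" "local_pi_base K p \<V>"
    unfolding R_def by blast
  have "has_pi_character K p \<kappa>"
    unfolding has_pi_character_def
  proof (intro conjI exI allI impI)
    show "Card_order \<kappa>" "local_pi_base K p \<V>" "|\<V>| =o \<kappa>"
      using \<V> card_of_Card_order card_of_refl by auto
    show "\<kappa> \<le>o |\<W>|" if "local_pi_base K p \<W>" for \<W>
      using that \<open>\<forall>r\<in>R. \<kappa> \<le>o r\<close> unfolding R_def by blast
  qed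
  then show ?thesis
    by blast
qed

lemma has_pi_character_le:
  assumes "has_pi_character K p \<kappa>" and "has_pi_character K p \<kappa>'"
  shows "\<kappa> \<le>o \<kappa>'"
proof -
  obtain \<V> where \<V>: "local_pi_base K p \<V>" "|\<V>| =o \<kappa>'"
    using assms(2) unfolding has_pi_character_def by auto
  have "\<kappa> \<le>o |\<V>|"
    using assms(1) \<V>(1) unfolding has_pi_character_def by simp
  then show ?thesis
    by (rule ordLeq_ordIso_trans[OF _ \<V>(2)])
qed

lemma has_pi_character_unique:
  assumes "has_pi_character K p \<kappa>" and "has_pi_character K p \<kappa>'"
  shows "\<kappa> =o \<kappa>'"
  using has_pi_character_le[OF assms] has_pi_character_le[OF assms(2,1)]
  by (simp add: ordIso_iff_ordLeq)

end

(* A disjoint family of open sets has at most c < pi-chi(p,K) members, so it is not a local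
   pi-base at p: some neighbourhood of p contains no member, and its complement is a compact
   subset of X meeting every member.  For the product, index a local pi-base at p
   injectively by kappa as (V_a) and consider the pairwise disjoint open sets
   (V_a - {p}) x {a}.  A Lindelof set meeting all of them would project onto a Lindelof
   subset of X meeting every V_a; but since p is a P-point, a Lindelof subset of K - {p}
   misses a neighbourhood of p, which contains some V_a. *)
theory Submission
  imports Defs
begin

lemma cellular_family_not_local_pi_base:
  assumes "has_pi_character K p \<kappa>" and "has_cellularity K \<mu>" and "\<mu> <o \<kappa>"
    and "cellular_family K \<U>"
  shows "\<not> local_pi_base K p \<U>"
proof
  assume "local_pi_base K p \<U>"
  then have "\<kappa> \<le>o |\<U>|"
    using assms(1) unfolding has_pi_character_def by simp
  moreover have "|\<U>| \<le>o \<mu>"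
    using assms(2,4) unfolding has_cellularity_def by simp
  ultimately have "\<kappa> \<le>o \<mu>"
    by (rule ordLeq_transitive)
  then show False
    using not_ordLess_ordLeq[OF assms(3)] by contradiction
qed

text \<open>Serves to show that \<open>p\<close> is not isolated: otherwise this one-member family
  would be cellular and a local \<pi>-base at once.\<close>

lemma local_pi_base_singleton:
  assumes "openin K {p}"
  shows "local_pi_base K p {{p}}"
  using assms unfolding local_pi_base_def by auto

text \<open>Separate each \<open>a\<close> in \<open>A\<close> from \<open>p\<close> by disjoint
  open sets \<open>U a\<close> and \<open>W a\<close>. Countably many \<open>U a\<close> cover
  \<open>A\<close>, and the P-point property turns the intersection of the matching
  \<open>W a\<close> into a neighbourhood of \<open>p\<close>, which avoids
  \<open>A\<close>.\<close>

lemma P_point_disjoint_Lindelof: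
  assumes p: "P_point K p" and "Hausdorff_space K"
    and A: "A \<subseteq> topspace K - {p}" and "Lindelof_space (subtopology K A)"
  obtains W where "openin K W" "p \<in> W" "W \<inter> A = {}"
proof -
  have pK: "p \<in> topspace K"
    using p unfolding P_point_def by blast
  have "\<exists>U W. openin K U \<and> openin K W \<and> a \<in> U \<and> p \<in> W \<and> disjnt U W" if "a \<in> A" for a
  proof -
    have "a \<in> topspace K \<and> p \<in> topspace K \<and> a \<noteq> p"
      using A that pK by blast
    then show ?thesis
      by (rule assms(2)[unfolded Hausdorff_space_def, rule_format])
  qed
  then obtain U W where UW: "\<And>a. a \<in> A \<Longrightarrow>
      openin K (U a) \<and> openin K (W a) \<and> a \<in> U a \<and> p \<in> W a \<and> disjnt (U a) (W a)"
    by metis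
  have "A \<subseteq> topspace K"
    using A by blast
  then have "\<forall>\<U>. (\<forall>V\<in>\<U>. openin K V) \<and> A \<subseteq> \<Union>\<U> \<longrightarrow>
      (\<exists>\<V>. countable \<V> \<and> \<V> \<subseteq> \<U> \<and> A \<subseteq> \<Union>\<V>)"
    using assms(4) by (simp only: Lindelof_space_subtopology_subset)
  moreover have "(\<forall>V\<in>U ` A. openin K V) \<and> A \<subseteq> \<Union>(U ` A)"
    using UW by blast
  ultimately have "\<exists>\<V>. countable \<V> \<and> \<V> \<subseteq> U ` A \<and> A \<subseteq> \<Union>\<V>"
    by (elim allE[of _ "U ` A"] impE)
  then obtain C where C: "countable C" "C \<subseteq> A" "A \<subseteq> \<Union>(U ` C)"
    unfolding ex_countable_subset_image by blast
  \<comment> \<open>\<open>C\<close> is empty when \<open>A\<close> is; inserting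
    \<open>topspace K\<close> keeps the family nonempty, as \<open>P_point\<close> demands.\<close>
  define \<N> where "\<N> = insert (topspace K) (W ` C)"
  have "neighborhood_in K p N" if "N \<in> \<N>" for N
  proof -
    have "openin K N" "p \<in> N"
      using that UW C(2) pK unfolding \<N>_def by auto
    then show ?thesis
      using openin_subset unfolding neighborhood_in_def by blast
  qed
  moreover have "countable \<N>" "\<N> \<noteq> {}"
    using C(1) unfolding \<N>_def by simp_all
  ultimately have "neighborhood_in K p (\<Inter>\<N>)"
    using p[unfolded P_point_def, THEN conjunct2, THEN spec[of _ \<N>]] by simp
  then obtain N where N: "openin K N" "p \<in> N" "N \<subseteq> \<Inter>\<N>"
    unfolding neighborhood_in_def by blast
  have "N \<inter> A = {}"
  proof (rule ccontr)
    assume "N \<inter> A \<noteq> {}"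
    then obtain x c where x: "x \<in> N" "c \<in> C" "x \<in> U c"
      using C(3) by blast
    then have "x \<in> W c"
      using N(3) unfolding \<N>_def by blast
    moreover have "disjnt (U c) (W c)"
      using UW C(2) x(2) by blast
    ultimately show False
      using x(3) unfolding disjnt_iff by blast
  qed
  with N(1,2) show thesis
    by (rule that)
qed

text \<open>Cardinals enter only through \<open>notbase\<close>. As points are closed, the punctured
  space is open in \<open>K\<close>, so its cellular families are cellular in \<open>K\<close> and
  \<open>notbase\<close> applies to them.\<close>

lemma cellular_compact_delete_point:
  assumes "compact_space K" and "t1_space K"
    and notbase: "\<And>\<U>. cellular_family K \<U> \<Longrightarrow> \<not> local_pi_base K p \<U>"
  shows "cellular_compact (subtopology K (topspace K - {p}))"
  unfolding cellular_compact_def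
proof (intro allI impI)
  fix \<U> assume \<U>: "cellular_family (subtopology K (topspace K - {p})) \<U>"
  have "openin K (topspace K - {p})"
    using assms(2) by (cases "p \<in> topspace K") (auto intro: openin_diff closedin_t1_singleton)
  then have open_iff: "openin (subtopology K (topspace K - {p})) U \<longleftrightarrow>
      openin K U \<and> U \<subseteq> topspace K - {p}" for U
    by (rule openin_open_subtopology)
  have K\<U>: "cellular_family K \<U>"
    using \<U> unfolding cellular_family_def open_iff by blast
  then have openU: "\<forall>U\<in>\<U>. openin K U \<and> U \<noteq> {}"
    unfolding cellular_family_def by (rule conjunct1)
  \<comment> \<open>The members of the family are open and nonempty, so it can only fail to be a
    local \<pi>-base through a neighbourhood of \<open>p\<close> that includes none of them.\<close>
  obtain W where W: "openin K W" "p \<in> W" "\<forall>U\<in>\<U>. \<not> U \<subseteq> W"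
    using notbase[OF K\<U>] openU unfolding local_pi_base_def by auto
  have "compactin K (topspace K - W)"
    using assms(1) W(1) by (simp add: closedin_compact_space closedin_diff)
  then have "compactin (subtopology K (topspace K - {p})) (topspace K - W)"
    using W(2) by (auto simp: compactin_subtopology)
  moreover have "(topspace K - W) \<inter> U \<noteq> {}" if "U \<in> \<U>" for U
  proof -
    have "U \<subseteq> topspace K"
      using openU that openin_subset by auto
    then show ?thesis
      using W(3) that by blast
  qed
  ultimately show "\<exists>L. compactin (subtopology K (topspace K - {p})) L \<and> (\<forall>U\<in>\<U>. L \<inter> U \<noteq> {})"
    by blast
qed

lemma Lindelof_space_subtopology_fst_image:
  assumes "L \<subseteq> topspace (prod_topology X Y)"
    and "Lindelof_space (subtopology (prod_topology X Y) L)"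
  shows "Lindelof_space (subtopology X (fst ` L))"
proof (rule Lindelof_space_continuous_map_image[OF assms(2)])
  show "continuous_map (subtopology (prod_topology X Y) L) (subtopology X (fst ` L)) fst"
    by (auto simp: continuous_map_in_subtopology intro: continuous_map_from_subtopology continuous_map_fst)
  show "fst ` topspace (subtopology (prod_topology X Y) L) = topspace (subtopology X (fst ` L))"
    using assms(1) by (force simp: image_iff)
qed

lemma not_cellular_Lindelof_prod_Alexandroff:
  assumes "Hausdorff_space K" and p: "P_point K p" and isol: "\<not> openin K {p}"
    and base: "local_pi_base K p \<V>" and f: "inj_on f \<V>" "f ` \<V> \<subseteq> I"
  shows "\<not> cellular_Lindelof (prod_topology (subtopology K (topspace K - {p}))
           (Alexandroff_compactification (discrete_topology I)))"
    (is "\<not> cellular_Lindelof (prod_topology ?X ?Y)")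
proof
  assume cL: "cellular_Lindelof (prod_topology ?X ?Y)"
  \<comment> \<open>Members of \<open>\<V>\<close> may overlap; the isolated points
    \<open>Some (f V)\<close>, distinct because \<open>f\<close> is injective, make the boxes
    disjoint. The singleton is written as an image to match
    \<open>openin_Alexandroff_compactification_image_Some\<close>.\<close>
  define B where "B V = (V - {p}) \<times> Some ` {f V}" for V
  have "openin (prod_topology ?X ?Y) (B V) \<and> B V \<noteq> {}" if V: "V \<in> \<V>" for V
  proof
    have oV: "openin K V" "V \<noteq> {}"
      using base V unfolding local_pi_base_def by auto
    have "V - {p} = (topspace K - {p}) \<inter> V"
      using openin_subset[OF oV(1)] by blast
    then have "openin ?X (V - {p})"
      using oV(1) by (metis openin_subtopology_Int2)
    moreover have "openin ?Y (Some ` {f V})"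
      unfolding openin_Alexandroff_compactification_image_Some using f(2) V by auto
    ultimately show "openin (prod_topology ?X ?Y) (B V)"
      unfolding B_def by (simp only: openin_prod_Times_iff simp_thms)
    \<comment> \<open>Here \<open>isol\<close> is essential: it keeps \<open>V - {p}\<close>, and
      hence the box, from being empty.\<close>
    have "V \<noteq> {p}"
      using oV(1) isol by blast
    then show "B V \<noteq> {}"
      using oV(2) unfolding B_def by blast
  qed
  moreover have "pairwise disjnt (B ` \<V>)"
    using f(1) unfolding pairwise_image B_def pairwise_def disjnt_def inj_on_def by blast
  ultimately have "cellular_family (prod_topology ?X ?Y) (B ` \<V>)"
    unfolding cellular_family_def by blast
  then obtain L where L: "L \<subseteq> topspace (prod_topology ?X ?Y)"
      "Lindelof_space (subtopology (prod_topology ?X ?Y) L)" "\<forall>U\<in>B ` \<V>. L \<inter> U \<noteq> {}"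
    using cL unfolding cellular_Lindelof_def by (elim allE[of _ "B ` \<V>"]) blast
  have sub: "fst ` L \<subseteq> topspace K - {p}"
    using L(1) by auto
  have "Lindelof_space (subtopology K (fst ` L))"
    using Lindelof_space_subtopology_fst_image[OF L(1,2)] sub
    by (simp add: subtopology_subtopology Int_absorb1)
  then obtain W where W: "openin K W" "p \<in> W" "W \<inter> fst ` L = {}"
    using P_point_disjoint_Lindelof[OF p assms(1) sub] by blast
  then obtain V where V: "V \<in> \<V>" "V \<subseteq> W"
    using base unfolding local_pi_base_def by blast
  \<comment> \<open>The first coordinate of such a \<open>z\<close> lies in \<open>V\<close>, hence
    in \<open>W\<close>, although \<open>W\<close> misses the projection of
    \<open>L\<close>.\<close>
  obtain z where z: "z \<in> L" "z \<in> B V"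
    using L(3) V(1) by blast
  then have "fst z \<in> W"
    using V(2) unfolding B_def by auto
  then show False
    using z(1) W(3) by blast
qed

theorem theorem2p4:
  fixes K :: "'a topology" and p :: 'a and \<kappa> :: "'b rel" and X :: "'a topology"
  assumes "compact_space K" and "Hausdorff_space K"
    and "P_point K p"
    and "has_pi_character K p \<kappa>"
    and "has_cellularity K (ctwo ^c natLeq)"
    and "ctwo ^c natLeq <o \<kappa>"
    and "X = subtopology K (topspace K - {p})"
  shows "cellular_compact X \<and>
    \<not> cellular_Lindelof
        (prod_topology X (Alexandroff_compactification (discrete_topology (Field \<kappa>))))"
proof
  note notbase = cellular_family_not_local_pi_base[OF assms(4,5,6)]
  show "cellular_compact X"
    unfolding assms(7)
    by (rule cellular_compact_delete_point[OF assms(1) Hausdorff_imp_t1_space[OF assms(2)] notbase])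
  have isol: "\<not> openin K {p}"
  proof
    assume "openin K {p}"
    then have "cellular_family K {{p}}"
      unfolding cellular_family_def by simp
    then show False
      using notbase local_pi_base_singleton[OF \<open>openin K {p}\<close>] by blast
  qed
  obtain \<V> where \<V>: "local_pi_base K p \<V>" "|\<V>| =o \<kappa>"
    using assms(4) unfolding has_pi_character_def by blast
  have "Card_order \<kappa>"
    using assms(4) unfolding has_pi_character_def by blast
  \<comment> \<open>Since \<open>\<kappa>\<close> is a cardinal order, its field has cardinality
    \<open>\<kappa>\<close>, so a minimal local \<pi>-base can be labelled bijectively by the points
    of the discrete space.\<close>
  then have "|\<V>| =o |Field \<kappa>|"
    by (rule ordIso_transitive[OF \<V>(2) ordIso_symmetric[OF card_of_Field_ordIso]])
  then obtain f where "bij_betw f \<V> (Field \<kappa>)"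
    using card_of_ordIso by blast
  then show "\<not> cellular_Lindelof
      (prod_topology X (Alexandroff_compactification (discrete_topology (Field \<kappa>))))"
    unfolding assms(7)
    by (intro not_cellular_Lindelof_prod_Alexandroff[OF assms(2,3) isol \<V>(1)])
      (auto simp: bij_betw_def)
qed

end
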